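(* Let $a\in[0,1)$ and let $n$ be a positive integer. Let $A$ be the $n\times n$ complex matrix with entries $A_{ij}=\tilde e_j\!\left(\frac{i}{n}\right)$, $0\le i,j\le n-1$. Then $A$ is invertible, and the maps $\mathrm{dwft}(b)=A^{-1}b$ and $\mathrm{idwft}(b)=Ab$, $b\in\mathbb{C}^n$, are linear operators on $\mathbb{C}^n$ inverse to each other. In particular, when $a=0$, $\mathrm{dwft}$ is the classical Discrete Fourier Transform and $\mathrm{idwft}$ is the classical Inverse Discrete Fourier Transform.
   Context: For a fixed real $a\in[0,1)$ and $k\in\mathbb{Z}$, the functions $\tilde e_k$ are defined pointwise on $\mathbb{R}$ by the absolutely convergent series (with $a^0=1$, also when $a=0$; here $\mathrm{i}$ is the imaginary unit) $$\tilde e_k(x)=\begin{cases}1 & \text{if } k=0,\\ \sqrt{1-a^2}\,\sum_{m=0}^{\infty}a^m e^{2\pi \mathrm{i} k 2^m x} & \text{if } k \text{ is odd},\\ (1-a^2)\sum_{m=0}^{\infty}a^m e^{2\pi \mathrm{i} k 2^m x}-a\,e^{\pi \mathrm{i} k x} & \text{if } k \text{ is even and } k\neq 0.\end{cases}$$ Vectors of $\mathbb{C}^n$ are columns $b=(b_0,\dots,b_{n-1})^T$, indexed from $0$. The normalization of the classical transforms is: the Discrete Fourier Transform sends $b$ to $c$ with $c_j=\frac1n\sum_{l=0}^{n-1}b_l e^{-2\pi \mathrm{i} jl/n}$, and the Inverse Discrete Fourier Transform sends $c$ to $b$ with $b_l=\sum_{j=0}^{n-1}c_j e^{2\pi \mathrm{i}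 jl/n}$, for $0\le j,l\le n-1$. *)

theory Defs
  imports
    Complex_Main
    "Jordan_Normal_Form.Gauss_Jordan_Elimination"
    "Jordan_Normal_Form.VS_Connect"
begin

definition e_tilde :: "real \<Rightarrow> int \<Rightarrow> real \<Rightarrow> complex" where
  "e_tilde a k x =
    (if k = 0 then 1
     else if odd k then
       of_real (sqrt (1 - a\<^sup>2)) *
         (\<Sum>m. of_real (a ^ m) * exp (2 * of_real pi * \<i> * of_int k * 2 ^ m * of_real x))
     else
       of_real (1 - a\<^sup>2) *
         (\<Sum>m. of_real (a ^ m) * exp (2 * of_real pi * \<i> * of_int k * 2 ^ m * of_real x))
       - of_real a * exp (of_real pi * \<i> * of_int k * of_real x))"

text \<open>For \<open>0 \<le> a < 1\<close> the series above converges absolutely, so \<open>suminf\<close> is its actual sum.\<close>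

lemma summable_norm_e_tilde_series:
  fixes a x :: real and k :: int
  assumes "0 \<le> a" and "a < 1"
  shows "summable (\<lambda>m. norm (of_real (a ^ m) *
           exp (2 * of_real pi * \<i> * of_int k * 2 ^ m * of_real x) :: complex))"
proof -
  have "norm (of_real (a ^ m) *
      exp (2 * of_real pi * \<i> * of_int k * 2 ^ m * of_real x) :: complex) = a ^ m" for m
  proof -
    have "2 * of_real pi * \<i> * of_int k * 2 ^ m * of_real x
        = \<i> * of_real (2 * pi * of_int k * 2 ^ m * x)"
      by simp
    then have "norm (exp (2 * of_real pi * \<i> * of_int k * 2 ^ m * of_real x) :: complex) = 1"
      by (simp only: norm_exp_eq_Re) simp
    then show ?thesis
      using assms by (simp add: norm_mult norm_power)
  qed
  then show ?thesis
    using assms by (simp add: summable_geometric)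
qed

definition wavelet_mat :: "real \<Rightarrow> nat \<Rightarrow> complex mat" where
  "wavelet_mat a n = mat n n (\<lambda>(i, j). e_tilde a (int j) (real i / real n))"

text \<open>\<^const>\<open>mat_inverse\<close> returns \<^const>\<open>None\<close> on non-invertible matrices, in which case
  \<open>dwft\<close> is unspecified.\<close>

definition dwft :: "real \<Rightarrow> nat \<Rightarrow> complex vec \<Rightarrow> complex vec" where
  "dwft a n b = the (mat_inverse (wavelet_mat a n)) *\<^sub>v b"

definition idwft :: "real \<Rightarrow> nat \<Rightarrow> complex vec \<Rightarrow> complex vec" where
  "idwft a n b = wavelet_mat a n *\<^sub>v b"

definition dft :: "nat \<Rightarrow> complex vec \<Rightarrow> complex vec" where
  "dft n b = vec n (\<lambda>j. 1 / of_nat n *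
     (\<Sum>l = 0..<n. b $ l * exp (- 2 * of_real pi * \<i> * of_nat j * of_nat l / of_nat n)))"

definition idft :: "nat \<Rightarrow> complex vec \<Rightarrow> complex vec" where
  "idft n c = vec n (\<lambda>l.
     \<Sum>j = 0..<n. c $ j * exp (2 * of_real pi * \<i> * of_nat j * of_nat l / of_nat n))"

end

theory Submission
  imports Defs
begin

text \<open>
  Write \<open>e k x = exp (2\<pi>\<i>kx)\<close>. The difference \<open>e_tilde a k x - a * e_tilde a k (2 * x)\<close> telescopes
  to \<open>c * e k x\<close> with a constant \<open>c \<noteq> 0\<close>, minus \<open>a * e (k/2) x\<close> if \<open>k \<noteq> 0\<close> is even. Sampled at
  \<open>x = i/n\<close> this reads \<open>(1 - aP) A = F N\<close>: here \<open>P\<close> is the matrix of \<open>i \<mapsto> 2i mod n\<close>, \<open>F\<close> is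
  the matrix of the inverse discrete Fourier transform, and \<open>N\<close> is upper triangular, because
  \<open>k/2 < k\<close>, with nonzero diagonal. Hence \<open>det (1 - aP) det A = det F det N \<noteq> 0\<close>. For \<open>a = 0\<close>
  the matrix \<open>A\<close> is \<open>F\<close> itself.
\<close>

section \<open>The functions \<open>e_tilde\<close>\<close>

text \<open>The series shared by the odd and the even case. With \<open>cis\<close> of a real
  argument each term visibly has norm \<open>a ^ m\<close>.\<close>

definition e_series :: "real \<Rightarrow> int \<Rightarrow> real \<Rightarrow> complex" where
  "e_series a k x = (\<Sum>m. of_real (a ^ m) * cis (2 * pi * of_int k * 2 ^ m * x))"

lemma e_tilde_eq_e_series:
  "e_tilde a k x =
    (if k = 0 then 1
     else if odd k then of_real (sqrt (1 - a\<^sup>2)) * e_series a k x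
     else of_real (1 - a\<^sup>2) * e_series a k x
       - of_real a * cis (2 * pi * of_int (k div 2) * x))"
proof -
  have exp_term: "exp (2 * of_real pi * \<i> * of_int k * 2 ^ m * of_real x)
      = cis (2 * pi * of_int k * 2 ^ m * x)" for m
    by (simp add: cis_conv_exp mult_ac)
  have "exp (of_real pi * \<i> * of_int k * of_real x)
      = cis (2 * pi * of_int (k div 2) * x)" if "even k"
  proof -
    from that obtain l where "k = 2 * l" ..
    then show ?thesis by (simp add: cis_conv_exp mult_ac)
  qed
  then show ?thesis
    by (simp add: e_tilde_def e_series_def exp_term)
qed

text \<open>Split off the term \<open>m = 0\<close>; since
  \<open>2 ^ Suc m * x = 2 ^ m * (2 * x)\<close>, what remains is \<open>a\<close> times the series
  at \<open>2 * x\<close>.\<close>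

lemma e_series_unfold:
  assumes "0 \<le> a" "a < 1"
  shows "e_series a k x = cis (2 * pi * of_int k * x) + of_real a * e_series a k (2 * x)"
proof -
  define t where "t m = complex_of_real (a ^ m) * cis (2 * pi * of_int k * 2 ^ m * x)" for m
  define u where "u m = complex_of_real (a ^ m) * cis (2 * pi * of_int k * 2 ^ m * (2 * x))" for m
  have summable_t: "summable t" and summable_u: "summable u"
    by (rule summable_norm_cancel,
        use assms in \<open>simp add: t_def u_def norm_mult norm_power summable_geometric\<close>)+
  have "t (Suc m) = of_real a * u m" for m
    by (simp add: t_def u_def mult_ac)
  then have "(\<Sum>m. t (Suc m)) = of_real a * suminf u"
    by (simp add: suminf_mult summable_u)
  then have "suminf t = t 0 + of_real a * suminf u"
    using suminf_split_head[OF summable_t] by (simp add: diff_eq_eq add.commute)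
  moreover have "suminf t = e_series a k x" "suminf u = e_series a k (2 * x)"
    by (simp_all only: e_series_def t_def[abs_def] u_def[abs_def])
  moreover have "t 0 = cis (2 * pi * of_int k * x)"
    by (simp add: t_def)
  ultimately show ?thesis by simp
qed

lemma cis_add_int_multiple [simp]:
  "cis (2 * pi * of_int k * (x + of_int p)) = cis (2 * pi * of_int k * x)"
proof -
  have "2 * pi * of_int k * (x + of_int p)
      = 2 * pi * of_int k * x + 2 * pi * of_int (k * p)"
    by (simp add: algebra_simps)
  then show ?thesis
    by (simp only: cis_mult[symmetric]) simp
qed

lemma e_series_add_int [simp]: "e_series a k (x + of_int p) = e_series a k x"
proof -
  have "cis (2 * pi * of_int k * 2 ^ m * (x + of_int p))
      = cis (2 * pi * of_int k * 2 ^ m * x)" for m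
    using cis_add_int_multiple[of "k * 2 ^ m" x p] by (simp add: mult.assoc)
  then show ?thesis
    by (simp add: e_series_def)
qed

lemma e_tilde_add_int [simp]: "e_tilde a k (x + of_int p) = e_tilde a k x"
  by (simp add: e_tilde_eq_e_series)

text \<open>By period 1, doubling a grid point \<open>i/n\<close> leads to the grid point with index
  \<open>2 * i mod n\<close>, so doubling acts on the samples as a matrix.\<close>

lemma e_tilde_mod:
  assumes "n > 0"
  shows "e_tilde a k (real (m mod n) / real n) = e_tilde a k (real m / real n)"
proof -
  have "real m = real (m div n) * real n + real (m mod n)"
    by (metis div_mult_mod_eq of_nat_add of_nat_mult)
  then have "real m / real n = real (m mod n) / real n + of_int (int (m div n))"
    using assms by (simp add: field_simps)
  then show ?thesis
    using e_tilde_add_int[of a k "real (m mod n) / real n" "int (m div n)"] by simp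
qed

definition diag_coeff :: "real \<Rightarrow> int \<Rightarrow> complex" where
  "diag_coeff a k =
    (if k = 0 then of_real (1 - a) else if odd k then of_real (sqrt (1 - a\<^sup>2)) else 1)"

lemma diag_coeff_nonzero:
  assumes "0 \<le> a" "a < 1"
  shows "diag_coeff a k \<noteq> 0"
  using assms by (auto simp: diag_coeff_def power2_eq_1_iff)

lemma e_tilde_minus_dilate:
  assumes "0 \<le> a" "a < 1"
  shows "e_tilde a k x - of_real a * e_tilde a k (2 * x) =
    diag_coeff a k * cis (2 * pi * of_int k * x)
    - (if k \<noteq> 0 \<and> even k then of_real a * cis (2 * pi * of_int (k div 2) * x) else 0)"
proof -
  define s where "s = e_series a k (2 * x)"
  have unfold: "e_series a k x = cis (2 * pi * of_int k * x) + of_real a * s"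
    unfolding s_def by (rule e_series_unfold[OF assms])
  consider "k = 0" | "odd k" | "k \<noteq> 0" "even k" by blast
  then show ?thesis
  proof cases
    case 1
    then show ?thesis by (simp add: e_tilde_eq_e_series diag_coeff_def)
  next
    case 2
    then have "k \<noteq> 0" by auto
    with 2 show ?thesis
      unfolding e_tilde_eq_e_series diag_coeff_def unfold s_def[symmetric]
      by (simp add: distrib_left mult.left_commute)
  next
    case 3
    define c where "c = cis (2 * pi * of_int k * x)"
    define d where "d = cis (2 * pi * of_int (k div 2) * x)"
    \<comment> \<open>At \<open>2 * x\<close> the correction term has the full frequency
      \<open>k\<close>. It contributes \<open>a\<^sup>2 * c\<close>, which raises the coefficient
      \<open>1 - a\<^sup>2\<close> of \<open>c\<close> to 1.\<close>
    from 3 have double: "cis (2 * pi * of_int (k div 2) * (2 * x)) = c"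
      unfolding c_def by (auto elim!: evenE simp: mult_ac)
    have "e_tilde a k x - of_real a * e_tilde a k (2 * x) =
        of_real (1 - a\<^sup>2) * (c + of_real a * s) - of_real a * d
        - of_real a * (of_real (1 - a\<^sup>2) * s - of_real a * c)"
      using 3 by (simp only: e_tilde_eq_e_series unfold s_def[symmetric] double
          c_def[symmetric] d_def[symmetric] if_False simp_thms)
    also have "\<dots> = c - of_real a * d"
      by (simp add: algebra_simps power2_eq_square)
    finally show ?thesis
      using 3 by (simp add: diag_coeff_def c_def d_def)
  qed
qed

section \<open>The Fourier matrix\<close>

definition idft_mat :: "nat \<Rightarrow> complex mat" where
  "idft_mat n = mat n n (\<lambda>(i, j). cis (2 * pi * real j * (real i / real n)))"

definition dft_mat :: "nat \<Rightarrow> complex mat" where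
  "dft_mat n = mat n n (\<lambda>(j, l). 1 / of_nat n * cis (- (2 * pi * real j * (real l / real n))))"

lemma idft_mat_carrier [simp]: "idft_mat n \<in> carrier_mat n n"
  by (simp add: idft_mat_def)

lemma dft_mat_carrier [simp]: "dft_mat n \<in> carrier_mat n n"
  by (simp add: dft_mat_def)

lemma idft_eq_mat:
  assumes "b \<in> carrier_vec n"
  shows "idft n b = idft_mat n *\<^sub>v b"
  using assms
  by (intro eq_vecI)
    (auto simp: idft_def idft_mat_def scalar_prod_def cis_conv_exp mult_ac intro!: sum.cong)

lemma dft_eq_mat:
  assumes "b \<in> carrier_vec n"
  shows "dft n b = dft_mat n *\<^sub>v b"
  using assms
  by (intro eq_vecI)
    (auto simp: dft_def dft_mat_def scalar_prod_def cis_conv_exp mult_ac sum_divide_distrib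
      intro!: sum.cong)

lemma dft_mat_mult_idft_mat:
  assumes "n > 0"
  shows "dft_mat n * idft_mat n = 1\<^sub>m n"
proof (rule eq_matI)
  fix j k
  assume "j < dim_row (1\<^sub>m n :: complex mat)" "k < dim_col (1\<^sub>m n :: complex mat)"
  then have jk: "j < n" "k < n" by auto
  \<comment> \<open>Each entry of the product is a geometric sum in this root of unity.\<close>
  define z where "z = cis (2 * pi * (real k - real j) / real n)"
  have prod: "1 / of_nat n * cis (- (2 * pi * real j * (real l / real n)))
      * cis (2 * pi * real k * (real l / real n)) = 1 / of_nat n * z ^ l" for l
    by (simp add: z_def DeMoivre cis_mult) (simp add: field_simps diff_divide_distrib)
  have entry: "(dft_mat n * idft_mat n) $$ (j, k) = 1 / of_nat n * (\<Sum>l<n. z ^ l)"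
    using jk by (simp add: dft_mat_def idft_mat_def scalar_prod_def prod sum_distrib_left
        atLeast0LessThan del: times_divide_eq_left times_divide_eq_right)
  have "z ^ n = cis (2 * pi * of_int (int k - int j))"
    using assms by (simp add: z_def DeMoivre)
  then have z_pow: "z ^ n = 1" by (simp del: of_int_diff)
  \<comment> \<open>Otherwise the distinct indices \<open>j\<close> and \<open>k\<close> below
    \<open>n\<close> would give the same \<open>n\<close>-th root of unity.\<close>
  have "z \<noteq> 1" if "j \<noteq> k"
  proof
    assume "z = 1"
    moreover have "cis (2 * pi * real k / real n) = z * cis (2 * pi * real j / real n)"
      by (simp add: z_def cis_mult) (simp add: field_simps diff_divide_distrib)
    ultimately have "cis (2 * pi * real k / real n) = cis (2 * pi * real j / real n)"
      by simp
    with bij_betw_roots_unity[OF assms] jk that show False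
      by (auto simp: bij_betw_def inj_on_def)
  qed
  then have "(\<Sum>l<n. z ^ l) = 0" if "j \<noteq> k"
    using that z_pow by (simp add: geometric_sum)
  moreover have "z = 1" if "j = k"
    using that by (simp add: z_def)
  ultimately show "(dft_mat n * idft_mat n) $$ (j, k) = 1\<^sub>m n $$ (j, k)"
    unfolding entry using jk assms by (cases "j = k") simp_all
qed (simp_all add: dft_mat_def idft_mat_def)

lemma det_idft_mat_nonzero:
  assumes "n > 0"
  shows "det (idft_mat n) \<noteq> 0"
proof -
  have "det (dft_mat n) * det (idft_mat n) = 1"
    using det_mult[OF dft_mat_carrier idft_mat_carrier] dft_mat_mult_idft_mat[OF assms]
    by (metis det_one)
  then show ?thesis by auto
qed

section \<open>Factorization of the wavelet matrix\<close>

text \<open>This is \<open>1 - aP\<close>. The two conditions are subtracted, not nested, because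
  they coincide in row 0, where the diagonal entry is \<open>1 - a\<close>.\<close>

definition dilate_mat :: "real \<Rightarrow> nat \<Rightarrow> complex mat" where
  "dilate_mat a n = mat n n (\<lambda>(i, k).
     (if k = i then 1 else 0) - (if k = 2 * i mod n then of_real a else 0))"

text \<open>Column \<open>j\<close> holds the coefficients of
  \<open>e_tilde a j x - a * e_tilde a j (2 * x)\<close> in the exponentials. The guard
  \<open>j \<noteq> 0\<close> matters: \<open>0 div 2 = 0\<close> would hit the diagonal.\<close>

definition freq_mat :: "real \<Rightarrow> nat \<Rightarrow> complex mat" where
  "freq_mat a n = mat n n (\<lambda>(i, j).
     (if i = j then diag_coeff a (int j) else 0)
     - (if j \<noteq> 0 \<and> even j \<and> i = j div 2 then of_real a else 0))"

lemma wavelet_mat_carrier [simp]: "wavelet_mat a n \<in> carrier_mat n n"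
  by (simp add: wavelet_mat_def)

lemma dilate_mat_carrier [simp]: "dilate_mat a n \<in> carrier_mat n n"
  by (simp add: dilate_mat_def)

lemma freq_mat_carrier [simp]: "freq_mat a n \<in> carrier_mat n n"
  by (simp add: freq_mat_def)

text \<open>Both entries at \<open>(i, j)\<close> are the value of
  \<open>e_tilde a j x - a * e_tilde a j (2 * x)\<close> at \<open>x = i/n\<close>: on the left by
  periodicity, on the right by its expansion in exponentials.\<close>

lemma dilate_mat_mult_wavelet_mat:
  assumes "0 \<le> a" "a < 1"
  shows "dilate_mat a n * wavelet_mat a n = idft_mat n * freq_mat a n"
proof (rule eq_matI)
  have int_div_2: "real_of_int (int j div 2) = real (j div 2)" for j
    by (metis of_int_of_nat_eq of_nat_numeral zdiv_int)
  fix i j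
  assume "i < dim_row (idft_mat n * freq_mat a n)" "j < dim_col (idft_mat n * freq_mat a n)"
  then have ij: "i < n" "j < n" by (auto simp: idft_mat_def freq_mat_def)
  let ?x = "real i / real n"
  have "(dilate_mat a n * wavelet_mat a n) $$ (i, j) =
      (\<Sum>k = 0..<n. (if k = i then e_tilde a (int j) (real k / real n) else 0)
         - (if k = 2 * i mod n then of_real a * e_tilde a (int j) (real k / real n) else 0))"
    using ij by (auto simp: dilate_mat_def wavelet_mat_def scalar_prod_def left_diff_distrib
        intro!: sum.cong)
  also have "\<dots> = e_tilde a (int j) ?x
      - of_real a * e_tilde a (int j) (real (2 * i mod n) / real n)"
    using ij by (simp add: sum_subtractf)
  also have "\<dots> = e_tilde a (int j) ?x - of_real a * e_tilde a (int j) (2 * ?x)"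
    using ij by (simp add: e_tilde_mod)
  also have "\<dots> = diag_coeff a (int j) * cis (2 * pi * real j * ?x)
      - (if j \<noteq> 0 \<and> even j then of_real a * cis (2 * pi * real (j div 2) * ?x) else 0)"
    using e_tilde_minus_dilate[OF assms, of "int j" ?x]
    by (simp add: int_div_2)
  \<comment> \<open>Each term becomes a sum with one nonzero summand; the index
    \<open>j div 2\<close> is in range because \<open>j < n\<close>.\<close>
  also have "\<dots> = (\<Sum>k = 0..<n.
      (if k = j then diag_coeff a (int j) * cis (2 * pi * real k * ?x) else 0)
      - (if k = j div 2 then
           if j \<noteq> 0 \<and> even j then of_real a * cis (2 * pi * real k * ?x) else 0 else 0))"
    using ij by (simp add: sum_subtractf)
  also have "\<dots> = (idft_mat n * freq_mat a n) $$ (i, j)"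
    using ij by (auto simp: idft_mat_def freq_mat_def scalar_prod_def right_diff_distrib mult_ac
        intro!: sum.cong)
  finally show "(dilate_mat a n * wavelet_mat a n) $$ (i, j)
      = (idft_mat n * freq_mat a n) $$ (i, j)" .
qed (simp_all add: dilate_mat_def wavelet_mat_def idft_mat_def freq_mat_def)

lemma det_freq_mat_nonzero:
  assumes "0 \<le> a" "a < 1"
  shows "det (freq_mat a n) \<noteq> 0"
proof -
  have "upper_triangular (freq_mat a n)"
    by (intro upper_triangularI) (auto simp: freq_mat_def)
  then have "det (freq_mat a n) = prod_list (diag_mat (freq_mat a n))"
    by (rule det_upper_triangular) (rule freq_mat_carrier)
  also have "\<dots> = (\<Prod>i = 0..<n. freq_mat a n $$ (i, i))"
    by (simp add: prod_list_diag_prod freq_mat_def)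
  also have "\<dots> = (\<Prod>i = 0..<n. diag_coeff a (int i))"
    by (intro prod.cong) (auto simp: freq_mat_def)
  also have "\<dots> \<noteq> 0"
    using diag_coeff_nonzero[OF assms] by simp
  finally show ?thesis .
qed

text \<open>In the factorization the right-hand determinants are nonzero, so no factor on the left
  can vanish.\<close>

lemma det_wavelet_mat_nonzero:
  assumes "0 \<le> a" "a < 1" "n > 0"
  shows "det (wavelet_mat a n) \<noteq> 0"
proof -
  have "det (dilate_mat a n) * det (wavelet_mat a n) = det (idft_mat n) * det (freq_mat a n)"
    using dilate_mat_mult_wavelet_mat[OF assms(1,2), of n]
    by (metis det_mult dilate_mat_carrier wavelet_mat_carrier idft_mat_carrier freq_mat_carrier)
  with det_idft_mat_nonzero[OF assms(3)] det_freq_mat_nonzero[OF assms(1,2)]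
  show ?thesis by (metis mult_eq_0_iff)
qed

text \<open>At \<open>a = 0\<close> the unfolded series is a single exponential, and every
  normalizing factor is 1.\<close>

lemma wavelet_mat_0: "wavelet_mat 0 n = idft_mat n"
proof -
  have "e_series 0 k x = cis (2 * pi * of_int k * x)" for k x
    using e_series_unfold[of 0 k x] by simp
  then have "e_tilde 0 k x = cis (2 * pi * of_int k * x)" for k x
    by (simp add: e_tilde_eq_e_series)
  then show ?thesis
    by (simp add: wavelet_mat_def idft_mat_def)
qed

section \<open>Invertible matrices as linear operators\<close>

lemma mat_inverse_of_det_nonzero:
  fixes A :: "'a :: field mat"
  assumes "A \<in> carrier_mat n n" "det A \<noteq> 0"
  obtains B where "mat_inverse A = Some B" "A * B = 1\<^sub>m n" "B * A = 1\<^sub>m n" "B \<in> carrier_mat n n"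
proof (cases "mat_inverse A")
  case None
  then show ?thesis
    \<comment> \<open>\<open>None\<close> would mean that \<open>A\<close> is not a unit of the
      matrix ring; \<open>undefined\<close> fills the record extension of that ring.\<close>
    using mat_inverse(1)[OF assms(1)] det_non_zero_imp_unit[OF assms, of undefined] by metis
next
  case (Some B)
  then show ?thesis
    using mat_inverse(2)[OF assms(1)] that by blast
qed

lemma linear_map_mult_mat_vec:
  fixes A :: "'a :: field mat"
  assumes "A \<in> carrier_mat m n"
  shows "linear_map class_ring (module_vec TYPE('a) n) (module_vec TYPE('a) m) ((*\<^sub>v) A)"
proof -
  have "(*\<^sub>v) A \<in> LinearCombinations.module_hom class_ring (module_vec TYPE('a) n) (module_vec TYPE('a) m)"
    using assms
    by (auto simp: LinearCombinations.module_hom_def module_vec_simps mult_add_distrib_mat_vec mult_mat_vec)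
  then show ?thesis
    unfolding linear_map_def mod_hom_def mod_hom_axioms_def
    using vec_vs vec_module by blast
qed

theorem theorem3p1:
  fixes a :: real and n :: nat
  assumes "0 \<le> a" and "a < 1" and "n > 0"
  shows "invertible_mat (wavelet_mat a n)
    \<and> linear_map class_ring (module_vec TYPE(complex) n) (module_vec TYPE(complex) n) (dwft a n)
    \<and> linear_map class_ring (module_vec TYPE(complex) n) (module_vec TYPE(complex) n) (idwft a n)
    \<and> (\<forall>b \<in> carrier_vec n. dwft a n (idwft a n b) = b \<and> idwft a n (dwft a n b) = b)
    \<and> (a = 0 \<longrightarrow> (\<forall>b \<in> carrier_vec n. dwft a n b = dft n b \<and> idwft a n b = idft n b))"
proof -
  let ?A = "wavelet_mat a n"
  obtain B where B: "mat_inverse ?A = Some B" "?A * B = 1\<^sub>m n" "B * ?A = 1\<^sub>m n"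
      "B \<in> carrier_mat n n"
    using mat_inverse_of_det_nonzero[OF wavelet_mat_carrier det_wavelet_mat_nonzero[OF assms]]
    by blast
  have idwft: "idwft a n = (*\<^sub>v) ?A"
    by (simp add: idwft_def fun_eq_iff)
  have dwft: "dwft a n = (*\<^sub>v) B"
    by (simp add: dwft_def fun_eq_iff B(1))
  have "invertible_mat ?A"
    using B carrier_matD[OF wavelet_mat_carrier[of a n]]
    by (auto simp: invertible_mat_def inverts_mat_def)
  moreover have "linear_map class_ring (module_vec TYPE(complex) n) (module_vec TYPE(complex) n)
      (dwft a n)"
    unfolding dwft by (rule linear_map_mult_mat_vec) (rule B(4))
  moreover have "linear_map class_ring (module_vec TYPE(complex) n) (module_vec TYPE(complex) n)
      (idwft a n)"
    unfolding idwft by (rule linear_map_mult_mat_vec) simp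
  moreover have "dwft a n (idwft a n b) = b \<and> idwft a n (dwft a n b) = b"
    if b: "b \<in> carrier_vec n" for b
    unfolding dwft idwft
    using assoc_mult_mat_vec[OF B(4) wavelet_mat_carrier[of a n] b]
      assoc_mult_mat_vec[OF wavelet_mat_carrier[of a n] B(4) b] b
    by (simp add: B(2,3))
  moreover have "dwft a n b = dft n b \<and> idwft a n b = idft n b"
    if a: "a = 0" and b: "b \<in> carrier_vec n" for b
  proof -
    have A: "?A = idft_mat n"
      by (simp add: a wavelet_mat_0)
    \<comment> \<open>Uniqueness of inverses: \<open>dft_mat n\<close> is a left inverse and
      \<open>B\<close> a right inverse of the same matrix.\<close>
    have "B = dft_mat n * idft_mat n * B"
      using B(4) by (simp add: dft_mat_mult_idft_mat[OF assms(3)])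
    also have "\<dots> = dft_mat n * (idft_mat n * B)"
      by (rule assoc_mult_mat[OF dft_mat_carrier idft_mat_carrier B(4)])
    also have "\<dots> = dft_mat n"
      using B(2) by (simp add: A right_mult_one_mat[OF dft_mat_carrier])
    finally show ?thesis
      using b by (simp add: dwft idwft A dft_eq_mat idft_eq_mat)
  qed
  ultimately show ?thesis by blast
qed

end
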